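(* Let $A$ be a $\mathbb{C}[\partial]$-module with two $\mathbb{C}$-bilinear maps $\prec_\lambda,\succ_\lambda:A\otimes A\to A[\lambda]$ and two commuting $\mathbb{C}$-linear maps $\alpha,\beta:A\to A$ that are multiplicative with respect to $\prec_\lambda$ and $\succ_\lambda$, i.e. $\alpha(p\prec_\lambda q)=\alpha(p)\prec_\lambda\alpha(q)$, $\alpha(p\succ_\lambda q)=\alpha(p)\succ_\lambda\alpha(q)$, and likewise for $\beta$. Define $p*_\lambda q=p\prec_\lambda q+p\succ_\lambda q$ for all $p,q\in A$. Then $(A,\prec_\lambda,\succ_\lambda,\alpha,\beta)$ is a BiHom-dendriform conformal algebra if and only if $(A,*_\lambda,\alpha,\beta)$ is a BiHom-associative conformal algebra and $(A,\alpha,\beta)$ is a conformal bimodule over $(A,*_\lambda,\alpha,\beta)$ with left action $p_\lambda m=p\succ_\lambda m$ and right action $m_\lambda p=m\prec_\lambda p$ for all $p,m\in A$.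
   Context: All vector spaces, linear maps and tensor products are over $\mathbb{C}$; $\lambda,\mu$ are formal variables. For a $\mathbb{C}[\partial]$-module $V$ put $V[\lambda]=\mathbb{C}[\lambda]\otimes V$. A $\mathbb{C}$-bilinear map $U\otimes V\to W[\lambda]$, $u\otimes v\mapsto u\circ_\lambda v$, is conformal sesquilinear if $(\partial u)\circ_\lambda v=-\lambda(u\circ_\lambda v)$ and $u\circ_\lambda(\partial v)=(\partial+\lambda)(u\circ_\lambda v)$. Linear maps and products are extended coefficientwise to polynomials in $\lambda,\mu$; e.g. if $u\circ_\lambda v=\sum_i\lambda^i a_i$ then $(u\circ_\lambda v)\circ_{\lambda+\mu}w=\sum_i\lambda^i(a_i\circ_{\lambda+\mu}w)$. A BiHom-associative conformal algebra $(A,\cdot_\lambda,\alpha,\beta)$, with product written $p_\lambda q$, is a $\mathbb{C}[\partial]$-module $A$ with a conformal sesquilinear map $A\otimes A\to A[\lambda]$, $p\otimes q\mapsto p_\lambda q$, and commuting $\mathbb{C}$-linear maps $\alpha,\beta:A\to A$ commuting with $\partial$, such that $\alpha(p_\lambda q)=\alpha(p)_\lambda\alpha(q)$, $\beta(p_\lambda q)=\beta(p)_\lambda\beta(q)$ and $\alpha(p)_\lambda(q_\mu r)=(p_\lambda q)_{\lambda+\mu}\beta(r)$. A BiHom-dendriform conformal algebra $(A,\prec_\lambda,\succ_\lambda,\alpha,\beta)$ is a $\mathbb{C}[\partial]$-module $A$ with conformal sesquilinear maps $\prec_\lambda,\succ_\lambda:A\otimes A\to A[\lambda]$ and commuting $\mathbb{C}$-linear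 maps $\alpha,\beta:A\to A$ commuting with $\partial$ and multiplicative for both products, such that for all $p,q,r\in A$: $(p\prec_\lambda q)\prec_{\lambda+\mu}\beta(r)=\alpha(p)\prec_\lambda(q\prec_\mu r+q\succ_\mu r)$; $(p\succ_\lambda q)\prec_{\lambda+\mu}\beta(r)=\alpha(p)\succ_\lambda(q\prec_\mu r)$; $\alpha(p)\succ_\lambda(q\succ_\mu r)=(p\prec_\lambda q+p\succ_\lambda q)\succ_{\lambda+\mu}\beta(r)$. A conformal bimodule over a BiHom-associative conformal algebra $(A,\cdot_\lambda,\alpha_A,\beta_A)$ is a $\mathbb{C}[\partial]$-module $M$ with commuting $\mathbb{C}$-linear maps $\alpha_M,\beta_M:M\to M$ commuting with $\partial$ and conformal sesquilinear maps $A\otimes M\to M[\lambda]$, $p\otimes m\mapsto p_\lambda m$, and $M\otimes A\to M[\lambda]$, $m\otimes p\mapsto m_\lambda p$, such that $\alpha_M(p_\lambda m)=\alpha_A(p)_\lambda\alpha_M(m)$, $\alpha_M(m_\lambda p)=\alpha_M(m)_\lambda\alpha_A(p)$, the same for $\beta$, and $(p_\lambda q)_{\lambda+\mu}\beta_M(m)=\alpha_A(p)_\lambda(q_\mu m)$, $(m_\lambda p)_{\lambda+\mu}\beta_A(q)=\alpha_M(m)_\lambda(p_\mu q)$, $(p_\lambda m)_{\lambda+\mu}\beta_A(q)=\alpha_A(p)_\lambda(m_\mu q)$ for all $p,q\in A$, $m\in M$. *)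

theory Defs
  imports Complex_Main "HOL-Computational_Algebra.Polynomial"
begin

text \<open>
  A $\mathbb{C}[\partial]$-module is a \<^locale>\<open>module\<close> over \<^typ>\<open>complex poly\<close>; the polynomial
  variable acts as $\partial$ and the constant polynomials give the underlying complex vector space.
\<close>

definition cscale :: "(complex poly \<Rightarrow> 'v \<Rightarrow> 'v) \<Rightarrow> complex \<Rightarrow> 'v \<Rightarrow> 'v" where
  "cscale s c v = s [:c:] v"

definition dd :: "(complex poly \<Rightarrow> 'v \<Rightarrow> 'v) \<Rightarrow> 'v \<Rightarrow> 'v" where
  "dd s v = s [:0, 1:] v"

text \<open>
  $V[\lambda]$ is \<^typ>\<open>'v poly\<close> (only \<^typ>\<open>'v\<close> being an abelian group is needed, so there is no ring
  structure here), and coefficientwise extension of a map \<^term>\<open>f\<close> is \<^term>\<open>map_poly f\<close>.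
  Multiplication by $\lambda$ is \<^term>\<open>pCons 0\<close>.
\<close>

abbreviation clinear ::
  "(complex poly \<Rightarrow> 'u::ab_group_add \<Rightarrow> 'u) \<Rightarrow> (complex poly \<Rightarrow> 'v::ab_group_add \<Rightarrow> 'v) \<Rightarrow> ('u \<Rightarrow> 'v) \<Rightarrow> bool" where
  "clinear sU sV f \<equiv> Vector_Spaces.linear (cscale sU) (cscale sV) f"

definition lambda_bilinear ::
  "(complex poly \<Rightarrow> 'u::ab_group_add \<Rightarrow> 'u) \<Rightarrow> (complex poly \<Rightarrow> 'v::ab_group_add \<Rightarrow> 'v) \<Rightarrow>
   (complex poly \<Rightarrow> 'w::ab_group_add \<Rightarrow> 'w) \<Rightarrow> ('u \<Rightarrow> 'v \<Rightarrow> 'w poly) \<Rightarrow> bool" where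
  "lambda_bilinear sU sV sW B \<longleftrightarrow>
     (\<forall>u. Vector_Spaces.linear (cscale sV) (\<lambda>c. map_poly (cscale sW c)) (\<lambda>v. B u v)) \<and>
     (\<forall>v. Vector_Spaces.linear (cscale sU) (\<lambda>c. map_poly (cscale sW c)) (\<lambda>u. B u v))"

definition conformal_sesquilinear ::
  "(complex poly \<Rightarrow> 'u::ab_group_add \<Rightarrow> 'u) \<Rightarrow> (complex poly \<Rightarrow> 'v::ab_group_add \<Rightarrow> 'v) \<Rightarrow>
   (complex poly \<Rightarrow> 'w::ab_group_add \<Rightarrow> 'w) \<Rightarrow> ('u \<Rightarrow> 'v \<Rightarrow> 'w poly) \<Rightarrow> bool" where
  "conformal_sesquilinear sU sV sW B \<longleftrightarrow>
     lambda_bilinear sU sV sW B \<and>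
     (\<forall>u v. B (dd sU u) v = - pCons 0 (B u v)) \<and>
     (\<forall>u v. B u (dd sV v) = map_poly (dd sW) (B u v) + pCons 0 (B u v))"

text \<open>
  $V[\lambda,\mu]$ is \<^typ>\<open>'v poly poly\<close>, read as $V[\lambda][\mu]$: the outer variable is $\mu$, the
  inner one $\lambda$.
\<close>

definition mult_lambda :: "'v::ab_group_add poly poly \<Rightarrow> 'v poly poly" where
  "mult_lambda P = map_poly (pCons 0) P"

definition mult_mu :: "'v::ab_group_add poly poly \<Rightarrow> 'v poly poly" where
  "mult_mu P = pCons 0 P"

text \<open>The substitution $f(\lambda) \mapsto f(\lambda+\mu) = \sum_k (\lambda+\mu)^k f_k$.\<close>

definition at_lambda_plus_mu :: "'v::ab_group_add poly \<Rightarrow> 'v poly poly" where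
  "at_lambda_plus_mu f =
     (\<Sum>k\<le>degree f. ((\<lambda>P. mult_lambda P + mult_mu P) ^^ k) [:[:coeff f k:]:])"

text \<open>
  For $f = \sum_i \lambda^i a_i$: \<open>left_nested B f w\<close> is
  $f \circ_{\lambda+\mu} w = \sum_i \lambda^i (a_i \circ_{\lambda+\mu} w)$.
  For $g = \sum_j \mu^j c_j$: \<open>right_nested B u g\<close> is
  $u \circ_\lambda g = \sum_j \mu^j (u \circ_\lambda c_j)$.
\<close>

definition left_nested ::
  "('u::zero \<Rightarrow> 'v \<Rightarrow> 'w::ab_group_add poly) \<Rightarrow> 'u poly \<Rightarrow> 'v \<Rightarrow> 'w poly poly" where
  "left_nested B f w =
     (\<Sum>i\<le>degree f. (mult_lambda ^^ i) (at_lambda_plus_mu (B (coeff f i) w)))"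

definition right_nested ::
  "('u \<Rightarrow> 'v::zero \<Rightarrow> 'w::ab_group_add poly) \<Rightarrow> 'u \<Rightarrow> 'v poly \<Rightarrow> 'w poly poly" where
  "right_nested B u g = map_poly (B u) g"

definition multiplicative ::
  "('u \<Rightarrow> 'u) \<Rightarrow> ('v \<Rightarrow> 'v) \<Rightarrow> ('w::zero \<Rightarrow> 'w) \<Rightarrow> ('u \<Rightarrow> 'v \<Rightarrow> 'w poly) \<Rightarrow> bool" where
  "multiplicative f g h B \<longleftrightarrow> (\<forall>u v. map_poly h (B u v) = B (f u) (g v))"

locale bihom_module = module s
  for s :: "complex poly \<Rightarrow> 'v::ab_group_add \<Rightarrow> 'v" +
  fixes \<alpha> \<beta> :: "'v \<Rightarrow> 'v"
  assumes linear_\<alpha>: "clinear s s \<alpha>"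
    and linear_\<beta>: "clinear s s \<beta>"
    and \<alpha>_\<beta>_commute: "\<alpha> (\<beta> v) = \<beta> (\<alpha> v)"
    and \<alpha>_dd: "\<alpha> (dd s v) = dd s (\<alpha> v)"
    and \<beta>_dd: "\<beta> (dd s v) = dd s (\<beta> v)"

locale bihom_associative_conformal_algebra = bihom_module s \<alpha> \<beta>
  for s :: "complex poly \<Rightarrow> 'a::ab_group_add \<Rightarrow> 'a"
    and m :: "'a \<Rightarrow> 'a \<Rightarrow> 'a poly"
    and \<alpha> \<beta> :: "'a \<Rightarrow> 'a" +
  assumes sesquilinear: "conformal_sesquilinear s s s m"
    and mult_\<alpha>: "multiplicative \<alpha> \<alpha> \<alpha> m"
    and mult_\<beta>: "multiplicative \<beta> \<beta> \<beta> m"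
    and bihom_assoc: "right_nested m (\<alpha> p) (m q r) = left_nested m (m p q) (\<beta> r)"

locale bihom_dendriform_conformal_algebra = bihom_module s \<alpha> \<beta>
  for s :: "complex poly \<Rightarrow> 'a::ab_group_add \<Rightarrow> 'a"
    and prec succ :: "'a \<Rightarrow> 'a \<Rightarrow> 'a poly"
    and \<alpha> \<beta> :: "'a \<Rightarrow> 'a" +
  assumes sesquilinear_prec: "conformal_sesquilinear s s s prec"
    and sesquilinear_succ: "conformal_sesquilinear s s s succ"
    and prec_\<alpha>: "multiplicative \<alpha> \<alpha> \<alpha> prec"
    and prec_\<beta>: "multiplicative \<beta> \<beta> \<beta> prec"
    and succ_\<alpha>: "multiplicative \<alpha> \<alpha> \<alpha> succ"
    and succ_\<beta>: "multiplicative \<beta> \<beta> \<beta> succ"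
    and dendriform_1:
      "left_nested prec (prec p q) (\<beta> r) = right_nested prec (\<alpha> p) (prec q r + succ q r)"
    and dendriform_2:
      "left_nested prec (succ p q) (\<beta> r) = right_nested succ (\<alpha> p) (prec q r)"
    and dendriform_3:
      "right_nested succ (\<alpha> p) (succ q r) = left_nested succ (prec p q + succ p q) (\<beta> r)"

locale bihom_conformal_bimodule =
  A: bihom_associative_conformal_algebra sA mA \<alpha>A \<beta>A + M: bihom_module sM \<alpha>M \<beta>M
  for sA :: "complex poly \<Rightarrow> 'a::ab_group_add \<Rightarrow> 'a"
    and mA :: "'a \<Rightarrow> 'a \<Rightarrow> 'a poly"
    and \<alpha>A \<beta>A :: "'a \<Rightarrow> 'a"
    and sM :: "complex poly \<Rightarrow> 'm::ab_group_add \<Rightarrow> 'm"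
    and \<alpha>M \<beta>M :: "'m \<Rightarrow> 'm" +
  fixes lact :: "'a \<Rightarrow> 'm \<Rightarrow> 'm poly"
    and ract :: "'m \<Rightarrow> 'a \<Rightarrow> 'm poly"
  assumes sesquilinear_lact: "conformal_sesquilinear sA sM sM lact"
    and sesquilinear_ract: "conformal_sesquilinear sM sA sM ract"
    and lact_\<alpha>: "multiplicative \<alpha>A \<alpha>M \<alpha>M lact"
    and ract_\<alpha>: "multiplicative \<alpha>M \<alpha>A \<alpha>M ract"
    and lact_\<beta>: "multiplicative \<beta>A \<beta>M \<beta>M lact"
    and ract_\<beta>: "multiplicative \<beta>M \<beta>A \<beta>M ract"
    and lact_assoc: "left_nested lact (mA p q) (\<beta>M x) = right_nested lact (\<alpha>A p) (lact q x)"
    and ract_assoc: "left_nested ract (ract x p) (\<beta>A q) = right_nested ract (\<alpha>M x) (mA p q)"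
    and lact_ract: "left_nested ract (lact p x) (\<beta>A q) = right_nested lact (\<alpha>A p) (ract x q)"

end

theory Submission imports Defs begin

text \<open>
  Writing \<open>*\<close> for \<open>\<prec> + \<succ>\<close>, the three bimodule identities over \<open>(A, *)\<close> with
  \<open>\<succ>\<close> acting on the left and \<open>\<prec>\<close> on the right are, one by one, the three dendriform
  identities.  The right-hand side thus contains the left-hand side.  Conversely, a dendriform
  algebra only has to be shown to be associative for \<open>*\<close>.  For this, expand
  \<open>\<alpha>(p) *\<^sub>\<lambda> (q *\<^sub>\<mu> r)\<close> by additivity into
  \[ \alpha(p) \prec_\lambda (q *_\mu r) \;+\; \alpha(p) \succ_\lambda (q \prec_\mu r)
     \;+\; \alpha(p) \succ_\lambda (q \succ_\mu r). \]
  The dendriform identities turn the summands into \<open>\<beta>(r)\<close> multiplied on the left by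
  \<open>p \<prec> q\<close>, by \<open>p \<succ> q\<close> (both through \<open>\<prec>\<close>) and by \<open>p * q\<close> (through \<open>\<succ>\<close>), and these
  add up to \<open>(p *\<^sub>\<lambda> q) *\<^sub>\<lambda>\<^sub>+\<^sub>\<mu> \<beta>(r)\<close>.

  What needs proof is therefore that both ways of nesting products are additive, in the
  polynomial argument as well as in the product.  For the nesting on the left this is
  not immediate, because it is a sum whose range depends on the degree of the polynomial;
  \<open>sum_coeff_add\<close> takes care of that.  The remaining axioms for \<open>*\<close> (bilinearity,
  sesquilinearity, multiplicativity of the twisting maps) are linear in the product.
\<close>

section \<open>Additivity of nested products\<close>

lemma map_poly_additive:
  assumes "additive h"
  shows "additive (map_poly h)"
  by (rule additive.intro, rule poly_eqI)
     (simp add: coeff_map_poly additive.zero[OF assms] additive.add[OF assms])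

lemma map_poly_plus_fun:
  fixes f g :: "'a::zero \<Rightarrow> 'b::ab_group_add"
  assumes "f 0 = 0" "g 0 = 0"
  shows "map_poly (\<lambda>x. f x + g x) P = map_poly f P + map_poly g P"
  by (rule poly_eqI) (simp add: coeff_map_poly assms)

text \<open>
  The terms above the degree vanish, so two polynomials can be summed over a common range.
\<close>

lemma sum_coeff_extend:
  fixes F :: "nat \<Rightarrow> 'u::ab_group_add \<Rightarrow> 'v::ab_group_add"
  assumes "\<And>k. additive (F k)" "degree f \<le> n"
  shows "(\<Sum>k\<le>degree f. F k (coeff f k)) = (\<Sum>k\<le>n. F k (coeff f k))"
  by (rule sum.mono_neutral_left)
     (use assms in \<open>auto simp: coeff_eq_0 additive.zero\<close>)

text \<open>
  Both substitution of \<open>\<lambda> + \<mu>\<close> and nesting on the left have the form \<open>\<Sum>\<^sub>k F\<^sub>k(f\<^sub>k)\<close> over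
  \<open>k \<le> degree f\<close>.  Cancellation may make the degree of \<open>f + g\<close> drop, so additivity is seen
  only after all three sums are extended to the larger of the two degrees.
\<close>

lemma sum_coeff_add:
  fixes F :: "nat \<Rightarrow> 'u::ab_group_add \<Rightarrow> 'v::ab_group_add"
  assumes F: "\<And>k. additive (F k)"
  shows "(\<Sum>k\<le>degree (f + g). F k (coeff (f + g) k)) =
    (\<Sum>k\<le>degree f. F k (coeff f k)) + (\<Sum>k\<le>degree g. F k (coeff g k))"
proof -
  define n where "n = max (degree f) (degree g)"
  have "degree (f + g) \<le> n" "degree f \<le> n" "degree g \<le> n"
    by (auto simp: n_def degree_add_le_max)
  then show ?thesis
    by (simp only: sum_coeff_extend[of F _ n, OF F])
       (simp add: additive.add[OF F] sum.distrib)
qed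

lemma additive_funpow:
  fixes h :: "'a::ab_group_add \<Rightarrow> 'a"
  assumes "additive h"
  shows "additive (h ^^ n)"
  by (induction n) (auto simp: additive_def additive.add[OF assms])

lemma additive_mult_lambda: "additive mult_lambda"
  unfolding mult_lambda_def by (rule map_poly_additive) (simp add: additive_def)

lemma additive_at_lambda_plus_mu: "additive at_lambda_plus_mu"
proof -
  have step: "additive (\<lambda>P::'a poly poly. mult_lambda P + mult_mu P)"
    by (simp add: additive_def additive.add[OF additive_mult_lambda] mult_mu_def)
  have "additive (\<lambda>a::'a. ((\<lambda>P. mult_lambda P + mult_mu P) ^^ k) [:[:a:]:])" for k
    using additive.add[OF additive_funpow[OF step, of k], of "[:[:_:]:]" "[:[:_:]:]"]
    by (simp add: additive_def)
  from sum_coeff_add[OF this] show ?thesis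
    by (simp add: additive_def at_lambda_plus_mu_def)
qed

lemma left_nested_add_poly:
  assumes "\<And>w. additive (\<lambda>u. B u w)"
  shows "left_nested B (f + g) w = left_nested B f w + left_nested B g w"
proof -
  have "additive (\<lambda>a. (mult_lambda ^^ i) (at_lambda_plus_mu (B a w)))" for i
    by (simp add: additive_def additive.add[OF assms]
        additive.add[OF additive_at_lambda_plus_mu]
        additive.add[OF additive_funpow[OF additive_mult_lambda]])
  from sum_coeff_add[OF this] show ?thesis
    by (simp add: left_nested_def)
qed

lemma left_nested_plus_product:
  "left_nested (\<lambda>u v. B u v + C u v) f w = left_nested B f w + left_nested C f w"
  by (simp add: left_nested_def sum.distrib additive.add[OF additive_at_lambda_plus_mu]
      additive.add[OF additive_funpow[OF additive_mult_lambda]])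

lemma right_nested_add_poly:
  assumes "\<And>u. additive (B u)"
  shows "right_nested B u (f + g) = right_nested B u f + right_nested B u g"
  by (simp add: right_nested_def additive.add[OF map_poly_additive[OF assms]])

lemma right_nested_plus_product:
  fixes B C :: "'u \<Rightarrow> 'v::ab_group_add \<Rightarrow> 'w::ab_group_add poly"
  assumes "\<And>u. additive (B u)" "\<And>u. additive (C u)"
  shows "right_nested (\<lambda>u v. B u v + C u v) u g = right_nested B u g + right_nested C u g"
  by (simp add: right_nested_def map_poly_plus_fun additive.zero assms)

section \<open>Sums of conformal products\<close>

lemma lambda_bilinear_additive:
  assumes "lambda_bilinear sU sV sW B"
  shows "additive (B u)" "additive (\<lambda>u. B u v)"
  using assms unfolding lambda_bilinear_def additive_def
  by (auto dest!: spec simp: Vector_Spaces.linear_def module_hom_def module_hom_axioms_def)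

lemma linear_plus:
  assumes "Vector_Spaces.linear s1 s2 f" "Vector_Spaces.linear s1 s2 g"
  shows "Vector_Spaces.linear s1 s2 (\<lambda>x. f x + g x)"
proof -
  interpret f: Vector_Spaces.linear s1 s2 f by fact
  interpret vector_space_pair s1 s2 ..
  show ?thesis using assms by (rule linear_compose_add)
qed

lemma lambda_bilinear_plus:
  assumes "lambda_bilinear sU sV sW B" "lambda_bilinear sU sV sW C"
  shows "lambda_bilinear sU sV sW (\<lambda>u v. B u v + C u v)"
  using assms by (simp add: lambda_bilinear_def linear_plus)

lemma additive_dd: "module s \<Longrightarrow> additive (dd s)"
  by (simp add: additive_def dd_def module.scale_right_distrib)

lemma conformal_sesquilinear_plus:
  assumes "additive (dd sW)"
    and "conformal_sesquilinear sU sV sW B" "conformal_sesquilinear sU sV sW C"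
  shows "conformal_sesquilinear sU sV sW (\<lambda>u v. B u v + C u v)"
  using assms
  by (simp add: conformal_sesquilinear_def lambda_bilinear_plus
      additive.add[OF map_poly_additive[OF assms(1)]] algebra_simps)

lemma multiplicative_plus:
  assumes "additive h" "multiplicative f g h B" "multiplicative f g h C"
  shows "multiplicative f g h (\<lambda>u v. B u v + C u v)"
  using assms by (simp add: multiplicative_def additive.add[OF map_poly_additive])

lemma clinear_additive: "clinear s t f \<Longrightarrow> additive f"
  by (simp add: additive_def Vector_Spaces.linear_def module_hom_def module_hom_axioms_def)

section \<open>Dendriform algebras and bimodules\<close>

text \<open>
  The sum of the three dendriform identities is associativity of \<open>\<prec> + \<succ>\<close>.
\<close>

lemma (in bihom_dendriform_conformal_algebra) bihom_associative_sum:
  "bihom_associative_conformal_algebra s (\<lambda>p q. prec p q + succ p q) \<alpha> \<beta>"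
    (is "bihom_associative_conformal_algebra s ?star \<alpha> \<beta>")
proof unfold_locales
  show "conformal_sesquilinear s s s ?star"
    by (rule conformal_sesquilinear_plus[OF additive_dd[OF module_axioms]
          sesquilinear_prec sesquilinear_succ])
  show "multiplicative \<alpha> \<alpha> \<alpha> ?star"
    by (rule multiplicative_plus[OF clinear_additive[OF linear_\<alpha>] prec_\<alpha> succ_\<alpha>])
  show "multiplicative \<beta> \<beta> \<beta> ?star"
    by (rule multiplicative_plus[OF clinear_additive[OF linear_\<beta>] prec_\<beta> succ_\<beta>])
next
  fix p q r
  have bilinear: "lambda_bilinear s s s prec" "lambda_bilinear s s s succ"
    using sesquilinear_prec sesquilinear_succ by (simp_all add: conformal_sesquilinear_def)
  note add = lambda_bilinear_additive[OF bilinear(1)] lambda_bilinear_additive[OF bilinear(2)]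
  have "right_nested ?star (\<alpha> p) (?star q r) =
      right_nested prec (\<alpha> p) (?star q r) +
      (right_nested succ (\<alpha> p) (prec q r) + right_nested succ (\<alpha> p) (succ q r))"
    by (simp only: right_nested_plus_product add right_nested_add_poly)
  also have "\<dots> = left_nested prec (prec p q) (\<beta> r) +
      (left_nested prec (succ p q) (\<beta> r) + left_nested succ (?star p q) (\<beta> r))"
    by (simp only: dendriform_1 dendriform_2 dendriform_3)
  also have "\<dots> = left_nested ?star (?star p q) (\<beta> r)"
    by (simp only: left_nested_plus_product left_nested_add_poly[OF add(2)] add.assoc)
  finally show "right_nested ?star (\<alpha> p) (?star q r) = left_nested ?star (?star p q) (\<beta> r)" .
qed

theorem proposition2p6:
  fixes s :: "complex poly \<Rightarrow> 'a::ab_group_add \<Rightarrow> 'a"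
    and prec succ star :: "'a \<Rightarrow> 'a \<Rightarrow> 'a poly"
    and \<alpha> \<beta> :: "'a \<Rightarrow> 'a"
  assumes "module s"
    and "lambda_bilinear s s s prec" and "lambda_bilinear s s s succ"
    and "clinear s s \<alpha>" and "clinear s s \<beta>"
    and "\<And>p. \<alpha> (\<beta> p) = \<beta> (\<alpha> p)"
    and "multiplicative \<alpha> \<alpha> \<alpha> prec" and "multiplicative \<alpha> \<alpha> \<alpha> succ"
    and "multiplicative \<beta> \<beta> \<beta> prec" and "multiplicative \<beta> \<beta> \<beta> succ"
    and "\<And>p q. star p q = prec p q + succ p q"
  shows "bihom_dendriform_conformal_algebra s prec succ \<alpha> \<beta> \<longleftrightarrow>
    bihom_associative_conformal_algebra s star \<alpha> \<beta> \<and>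
    bihom_conformal_bimodule s star \<alpha> \<beta> s \<alpha> \<beta>
      (\<lambda>p m. succ p m) (\<lambda>m p. prec m p)"
proof -
  have star: "star = (\<lambda>p q. prec p q + succ p q)"
    using assms(11) by (intro ext)
  show ?thesis
    unfolding star
  proof (intro iffI conjI)
    assume "bihom_dendriform_conformal_algebra s prec succ \<alpha> \<beta>"
    then interpret D: bihom_dendriform_conformal_algebra s prec succ \<alpha> \<beta> .
    show assoc: "bihom_associative_conformal_algebra s (\<lambda>p q. prec p q + succ p q) \<alpha> \<beta>"
      by (rule D.bihom_associative_sum)
    show "bihom_conformal_bimodule s (\<lambda>p q. prec p q + succ p q) \<alpha> \<beta> s \<alpha> \<beta>
        (\<lambda>p m. succ p m) (\<lambda>m p. prec m p)"
      by (intro bihom_conformal_bimodule.intro bihom_conformal_bimodule_axioms.intro assoc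
          D.bihom_module_axioms D.sesquilinear_prec D.sesquilinear_succ
          D.prec_\<alpha> D.prec_\<beta> D.succ_\<alpha> D.succ_\<beta>
          D.dendriform_1 D.dendriform_2 D.dendriform_3[symmetric])
  next
    assume "bihom_associative_conformal_algebra s (\<lambda>p q. prec p q + succ p q) \<alpha> \<beta> \<and>
      bihom_conformal_bimodule s (\<lambda>p q. prec p q + succ p q) \<alpha> \<beta> s \<alpha> \<beta>
        (\<lambda>p m. succ p m) (\<lambda>m p. prec m p)"
    then interpret B: bihom_conformal_bimodule s "\<lambda>p q. prec p q + succ p q" \<alpha> \<beta> s \<alpha> \<beta>
        "\<lambda>p m. succ p m" "\<lambda>m p. prec m p"
      by blast
    show "bihom_dendriform_conformal_algebra s prec succ \<alpha> \<beta>"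
      by (intro bihom_dendriform_conformal_algebra.intro
          bihom_dendriform_conformal_algebra_axioms.intro B.A.bihom_module_axioms
          B.sesquilinear_ract B.sesquilinear_lact B.ract_\<alpha> B.ract_\<beta> B.lact_\<alpha> B.lact_\<beta>
          B.ract_assoc B.lact_ract B.lact_assoc[symmetric])
  qed
qed

end
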